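(* A real regular $L$-operator with parameter sequence $a=\{a_n\}_{n=0}^\infty$ is positive semi-definite if and only if $a_n>a_{n+1}$ for all $n\in\mathbb{N}_0$.
   Context: $\mathbb{N}_0=\{0,1,2,\dots\}$. An $L$-matrix with parameter sequence $a=\{a_n\}_{n=0}^\infty$ is the semi-infinite matrix $\mathcal{L}$ with $\mathcal{L}_{m,n}=a_{\max(m,n)}$, $m,n\in\mathbb{N}_0$. It is regular if $a_n\ne a_{n+1}$ for all $n\in\mathbb{N}_0$, and real if $a$ is a real sequence. For regular $\mathcal{L}$ put $b_n=\frac{1}{a_n-a_{n+1}}$ and let $\mathcal{J}$ be the tridiagonal matrix with $\mathcal{J}_{0,0}=b_0$, $\mathcal{J}_{n,n}=b_{n-1}+b_n$ for $n\ge1$, $\mathcal{J}_{n,n+1}=\mathcal{J}_{n+1,n}=-b_n$ for $n\ge0$, and other entries $0$. Let $J$ be the operator on $\ell^2(\mathbb{N}_0)$ with $Jx=\mathcal{J}\cdot x$ and $\mathrm{Dom}\,J=\{x\in\ell^2(\mathbb{N}_0):\mathcal{J}\cdot x\in\ell^2(\mathbb{N}_0)\}$; it coincides with the closure of its restriction to finitely supported sequences, and it is injective. The regular $L$-operator associated to $\mathcal{L}$ is $L:=J^{-1}$, with $\mathrm{Dom}\,L=\mathrm{Ran}\,J$. Positive semi-definite means $\langle x,Lx\rangle\ge0$ for all $x\in\mathrm{Dom}\,L$. *)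

theory Defs
  imports Complex_Main "HOL-Library.Nonpos_Ints"
begin

text \<open>Semi-infinite matrices are functions of type nat to nat to complex, row index first.\<close>

definition mat_vec :: "(nat \<Rightarrow> nat \<Rightarrow> complex) \<Rightarrow> (nat \<Rightarrow> complex) \<Rightarrow> nat \<Rightarrow> complex"
  where "mat_vec A x m = (\<Sum>n. A m n * x n)"

definition ell2 :: "(nat \<Rightarrow> complex) set"
  where "ell2 = {x. summable (\<lambda>n. (cmod (x n))\<^sup>2)}"

definition ell2_inner :: "(nat \<Rightarrow> complex) \<Rightarrow> (nat \<Rightarrow> complex) \<Rightarrow> complex"
  where "ell2_inner x y = (\<Sum>n. cnj (x n) * y n)"

definition L_matrix :: "(nat \<Rightarrow> complex) \<Rightarrow> nat \<Rightarrow> nat \<Rightarrow> complex"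
  where "L_matrix a m n = a (max m n)"

definition regular_param :: "(nat \<Rightarrow> complex) \<Rightarrow> bool"
  where "regular_param a \<longleftrightarrow> (\<forall>n. a n \<noteq> a (Suc n))"

definition J_coeff :: "(nat \<Rightarrow> complex) \<Rightarrow> nat \<Rightarrow> complex"
  where "J_coeff a n = 1 / (a n - a (Suc n))"

definition J_matrix :: "(nat \<Rightarrow> complex) \<Rightarrow> nat \<Rightarrow> nat \<Rightarrow> complex"
  where "J_matrix a m n =
    (if m = n then (if n = 0 then J_coeff a 0 else J_coeff a (n - 1) + J_coeff a n)
     else if n = Suc m then - J_coeff a m
     else if m = Suc n then - J_coeff a n
     else 0)"

text \<open>A possibly unbounded operator is represented by its domain together with a function
  whose values off the domain are irrelevant.\<close>

definition J_dom :: "(nat \<Rightarrow> complex) \<Rightarrow> (nat \<Rightarrow> complex) set"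
  where "J_dom a = {x \<in> ell2. mat_vec (J_matrix a) x \<in> ell2}"

definition J_op :: "(nat \<Rightarrow> complex) \<Rightarrow> (nat \<Rightarrow> complex) \<Rightarrow> nat \<Rightarrow> complex"
  where "J_op a = mat_vec (J_matrix a)"

definition L_dom :: "(nat \<Rightarrow> complex) \<Rightarrow> (nat \<Rightarrow> complex) set"
  where "L_dom a = J_op a ` J_dom a"

text \<open>For regular \<open>a\<close> this is a genuine inverse, by \<open>inj_on_J_op\<close> below.\<close>

definition L_op :: "(nat \<Rightarrow> complex) \<Rightarrow> (nat \<Rightarrow> complex) \<Rightarrow> nat \<Rightarrow> complex"
  where "L_op a = inv_into (J_dom a) (J_op a)"

text \<open>Over the complex numbers, nonnegativity of the quadratic form includes its being real.\<close>

definition pos_semidef ::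
    "(nat \<Rightarrow> complex) set \<Rightarrow> ((nat \<Rightarrow> complex) \<Rightarrow> nat \<Rightarrow> complex) \<Rightarrow> bool"
  where "pos_semidef D T \<longleftrightarrow> (\<forall>x\<in>D. ell2_inner x (T x) \<in> \<real>\<^sub>\<ge>\<^sub>0)"

lemma J_op_0: "J_op a x 0 = J_coeff a 0 * (x 0 - x 1)"
proof -
  have "(\<Sum>n. J_matrix a 0 n * x n) = (\<Sum>n\<in>{0,1}. J_matrix a 0 n * x n)"
    by (rule suminf_finite) (auto simp: J_matrix_def)
  then show ?thesis
    by (simp add: J_op_def mat_vec_def J_matrix_def algebra_simps)
qed

lemma J_op_Suc:
  "J_op a x (Suc m) = J_coeff a m * (x (Suc m) - x m)
     + J_coeff a (Suc m) * (x (Suc m) - x (Suc (Suc m)))"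
proof -
  have "(\<Sum>n. J_matrix a (Suc m) n * x n)
      = (\<Sum>n\<in>{m, Suc m, Suc (Suc m)}. J_matrix a (Suc m) n * x n)"
    by (rule suminf_finite) (auto simp: J_matrix_def)
  then show ?thesis
    by (simp add: J_op_def mat_vec_def J_matrix_def algebra_simps)
qed

lemma inj_on_J_op:
  assumes "regular_param a"
  shows "inj_on (J_op a) (J_dom a)"
proof (rule inj_onI)
  fix x y assume x: "x \<in> J_dom a" and y: "y \<in> J_dom a" and eq: "J_op a x = J_op a y"
  have nz: "J_coeff a n \<noteq> 0" for n
    using assms by (simp add: regular_param_def J_coeff_def)
  define d where "d n = x n - y n" for n
  have step: "d n = d (Suc n)" for n
  proof (induction n)
    case 0
    have "J_coeff a 0 * (d 0 - d 1) = 0"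
      using fun_cong[OF eq, of 0] by (simp add: J_op_0 d_def algebra_simps)
    then show ?case using nz by simp
  next
    case (Suc n)
    have "J_coeff a n * (d (Suc n) - d n)
        + J_coeff a (Suc n) * (d (Suc n) - d (Suc (Suc n))) = 0"
      using fun_cong[OF eq, of "Suc n"] by (simp add: J_op_Suc d_def algebra_simps)
    then show ?case using nz Suc by simp
  qed
  have const: "d n = d 0" for n
    by (induction n) (use step in auto)
  have lim0: "z \<longlonglongrightarrow> 0" if "z \<in> J_dom a" for z
  proof -
    have "summable (\<lambda>n. (cmod (z n))\<^sup>2)"
      using that by (simp add: J_dom_def ell2_def)
    then have "(\<lambda>n. (cmod (z n))\<^sup>2) \<longlonglongrightarrow> 0"
      by (rule summable_LIMSEQ_zero)
    from tendsto_real_sqrt[OF this] show ?thesis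
      by (auto intro: tendsto_norm_zero_cancel)
  qed
  have "d \<longlonglongrightarrow> 0"
    using tendsto_diff[OF lim0[OF x] lim0[OF y]] by (simp add: d_def[abs_def])
  moreover have "d = (\<lambda>n. d 0)"
    using const by blast
  ultimately have "d 0 = 0"
    by (metis LIMSEQ_const_iff)
  then show "x = y"
    using const by (auto simp: d_def fun_eq_iff)
qed

text \<open>The formal relation between the two matrices: their product is the identity.\<close>

lemma L_matrix_J_matrix:
  assumes "regular_param a"
  shows "mat_vec (L_matrix a) (\<lambda>k. J_matrix a k n) m = (if m = n then 1 else 0)"
proof (cases n)
  case 0
  have "(\<Sum>k. L_matrix a m k * J_matrix a k n) = (\<Sum>k\<in>{0,1}. L_matrix a m k * J_matrix a k n)"
    by (rule suminf_finite) (auto simp: J_matrix_def 0)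
  also have "\<dots> = J_coeff a 0 * (a m - a (max m 1))"
    by (simp add: J_matrix_def L_matrix_def 0 algebra_simps)
  also have "\<dots> = (if m = n then 1 else 0)"
    using assms by (cases m) (auto simp: 0 J_coeff_def regular_param_def)
  finally show ?thesis by (simp add: mat_vec_def)
next
  case (Suc p)
  have "(\<Sum>k. L_matrix a m k * J_matrix a k n)
      = (\<Sum>k\<in>{p, Suc p, Suc (Suc p)}. L_matrix a m k * J_matrix a k n)"
    by (rule suminf_finite) (auto simp: J_matrix_def Suc)
  also have "\<dots> = J_coeff a p * (a (max m (Suc p)) - a (max m p))
      + J_coeff a (Suc p) * (a (max m (Suc p)) - a (max m (Suc (Suc p))))"
    by (simp add: J_matrix_def L_matrix_def Suc algebra_simps)
  also have "\<dots> = (if m = n then 1 else 0)"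
  proof -
    have 1: "J_coeff a k * (a (Suc k) - a k) = -1" "J_coeff a k * (a k - a (Suc k)) = 1" for k
      using assms by (auto simp: J_coeff_def regular_param_def field_simps)
    consider "m \<le> p" | "m = Suc p" | "m = Suc (Suc p)" | "m > Suc (Suc p)" by linarith
    then show ?thesis
      by cases (auto simp: 1 Suc max_def)
  qed
  finally show ?thesis by (simp add: mat_vec_def)
qed

end

theory Submission
  imports Defs "HOL-Analysis.Analysis"
begin

text \<open>Write \<open>b\<^sub>n = 1 / (a\<^sub>n - a\<^sub>n\<^sub>+\<^sub>1)\<close>. Since the operator is the inverse of \<open>J\<close>, the claim
  concerns the form \<open>\<langle>Jx, x\<rangle>\<close> on the domain of \<open>J\<close>. Summation by parts turns its partial sums
  into \<open>\<Sum>b\<^sub>n |x\<^sub>n - x\<^sub>n\<^sub>+\<^sub>1|\<^sup>2\<close> plus a boundary term \<open>cnj s\<^sub>N * x\<^sub>N\<close>, where \<open>s\<^sub>N\<close> is the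
  \<open>N\<close>-th partial sum of \<open>Jx\<close>. By Cauchy-Schwarz \<open>s\<^sub>N = O(sqrt N)\<close>, while
  \<open>liminf sqrt N * |x\<^sub>N| = 0\<close> because the harmonic series diverges; so the boundary term vanishes
  along a subsequence. Conversely, the form takes the value \<open>b\<^sub>n\<close> at the indicator of
  \<open>{0, \<dots>, n}\<close>.\<close>

text \<open>Each entry of \<open>J_op a x\<close> is a difference of consecutive values of the flux
  \<open>J_coeff a n * (x n - x (Suc n))\<close>, so the sum telescopes.\<close>

lemma sum_J_op: "(\<Sum>n\<le>N. J_op a x n) = J_coeff a N * (x N - x (Suc N))"
  by (induction N) (simp_all add: J_op_0 J_op_Suc algebra_simps)

text \<open>The boundary term is kept as a partial sum of \<open>J_op a x\<close> instead of the
  equal flux: it can then be bounded by the \<open>ell2\<close> norm of \<open>J_op a x\<close>,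
  with no control on the size of \<open>J_coeff a\<close>.\<close>

lemma sum_J_op_form:
  "(\<Sum>n\<le>N. cnj (J_op a x n) * x n)
    = (\<Sum>n<N. cnj (J_coeff a n) * of_real ((cmod (x n - x (Suc n)))\<^sup>2))
      + cnj (\<Sum>n\<le>N. J_op a x n) * x N"
proof (induction N)
  case 0
  then show ?case by simp
next
  case (Suc N)
  \<comment> \<open>Once the partial sum is read as a flux, moving the other factor from
    \<open>x N\<close> to \<open>x (Suc N)\<close> costs exactly the next squared
    difference.\<close>
  have "cnj (\<Sum>n\<le>N. J_op a x n) * x N
      = cnj (J_coeff a N) * of_real ((cmod (x N - x (Suc N)))\<^sup>2)
        + cnj (\<Sum>n\<le>N. J_op a x n) * x (Suc N)"
    unfolding sum_J_op complex_norm_square by (simp add: algebra_simps)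
  with Suc.IH have "(\<Sum>n\<le>N. cnj (J_op a x n) * x n)
      = (\<Sum>n<Suc N. cnj (J_coeff a n) * of_real ((cmod (x n - x (Suc n)))\<^sup>2))
        + cnj (\<Sum>n\<le>N. J_op a x n) * x (Suc N)"
    by (simp only: sum.lessThan_Suc add.assoc)
  then show ?case
    by (simp only: sum.atMost_Suc complex_cnj_add distrib_right add.assoc)
qed

lemma summable_ell2_inner:
  assumes "x \<in> ell2" "y \<in> ell2"
  shows "summable (\<lambda>n. cnj (x n) * y n)"
proof (rule summable_comparison_test')
  show "summable (\<lambda>n. (cmod (x n))\<^sup>2 + (cmod (y n))\<^sup>2)"
    using assms by (auto simp: ell2_def intro: summable_add)
  show "norm (cnj (x n) * y n) \<le> (cmod (x n))\<^sup>2 + (cmod (y n))\<^sup>2" if "n \<ge> 0" for n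
  proof -
    have "2 * (cmod (x n) * cmod (y n)) \<le> (cmod (x n))\<^sup>2 + (cmod (y n))\<^sup>2"
      using sum_squares_bound[of "cmod (x n)" "cmod (y n)"] by simp
    moreover have "0 \<le> cmod (x n) * cmod (y n)"
      by simp
    ultimately show ?thesis
      unfolding norm_mult complex_mod_cnj by linarith
  qed
qed

lemma norm_sum_ell2_le:
  assumes "y \<in> ell2"
  shows "(cmod (\<Sum>n\<le>N. y n))\<^sup>2 \<le> real (Suc N) * (\<Sum>n. (cmod (y n))\<^sup>2)"
proof -
  have "(cmod (\<Sum>n\<le>N. y n))\<^sup>2 \<le> (\<Sum>n\<le>N. cmod (y n))\<^sup>2"
    by (intro power_mono norm_sum) simp
  also have "\<dots> \<le> real (Suc N) * (\<Sum>n\<le>N. (cmod (y n))\<^sup>2)"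
    using sum_squared_le_sum_of_squares[of "\<lambda>n. cmod (y n)" "{..N}"] by (simp add: mult.commute)
  also have "\<dots> \<le> real (Suc N) * (\<Sum>n. (cmod (y n))\<^sup>2)"
    using assms by (intro mult_left_mono sum_le_suminf) (auto simp: ell2_def)
  finally show ?thesis .
qed

lemma ell2_boundary_term_small:
  assumes x: "x \<in> ell2" and y: "y \<in> ell2" and e: "e > 0"
  shows "\<exists>N\<ge>M. cmod (cnj (\<Sum>n\<le>N. y n) * x N) < e"
proof (rule ccontr)
  assume "\<not> ?thesis"
  then have large: "e \<le> cmod (\<Sum>n\<le>N. y n) * cmod (x N)" if "N \<ge> M" for N
    using that by (metis norm_mult complex_mod_cnj not_less)
  \<comment> \<open>The added 1 keeps \<open>C\<close> positive even when \<open>y\<close> vanishes,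
    so dividing by it is safe.\<close>
  define C where "C = (\<Sum>n. (cmod (y n))\<^sup>2) + 1"
  have "C > 0"
    using y by (auto simp: C_def ell2_def intro!: add_nonneg_pos suminf_nonneg)
  \<comment> \<open>If the boundary term stays at least \<open>e\<close>, the squares of
    \<open>x\<close> dominate a positive multiple of the harmonic series.\<close>
  have bound: "e\<^sup>2 / C * inverse (real (Suc N)) \<le> (cmod (x N))\<^sup>2" if "N \<ge> M" for N
  proof -
    have "e\<^sup>2 \<le> (cmod (\<Sum>n\<le>N. y n) * cmod (x N))\<^sup>2"
      using large[OF that] e by (intro power_mono) auto
    also have "\<dots> = (cmod (\<Sum>n\<le>N. y n))\<^sup>2 * (cmod (x N))\<^sup>2"
      by (rule power_mult_distrib)
    also have "\<dots> \<le> (real (Suc N) * C) * (cmod (x N))\<^sup>2"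
    proof (rule mult_right_mono)
      show "(cmod (\<Sum>n\<le>N. y n))\<^sup>2 \<le> real (Suc N) * C"
        using norm_sum_ell2_le[OF y, of N] by (simp add: C_def algebra_simps)
    qed simp
    finally have "e\<^sup>2 \<le> (cmod (x N))\<^sup>2 * (C * real (Suc N))"
      by (simp only: mult_ac)
    moreover have "e\<^sup>2 / C * inverse (real (Suc N)) = e\<^sup>2 / (C * real (Suc N))"
      by (simp add: divide_inverse)
    ultimately show ?thesis
      using \<open>C > 0\<close> by (simp only: divide_le_eq mult_pos_pos of_nat_0_less_iff zero_less_Suc if_True)
  qed
  have "summable (\<lambda>N. e\<^sup>2 / C * inverse (real (Suc N)))"
  proof (rule summable_comparison_test'[where N = M])
    show "summable (\<lambda>n. (cmod (x n))\<^sup>2)"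
      using x by (simp add: ell2_def)
    show "norm (e\<^sup>2 / C * inverse (real (Suc n))) \<le> (cmod (x n))\<^sup>2" if "n \<ge> M" for n
      using bound[OF that] \<open>C > 0\<close> by simp
  qed
  then have "summable (\<lambda>N. inverse (real (Suc N)))"
    using e \<open>C > 0\<close> by (subst (asm) summable_cmult_iff) auto
  then have "summable (\<lambda>N. inverse (real N))"
    by (subst (asm) summable_Suc_iff)
  then show False
    using not_summable_harmonic[where 'a = real] by (simp add: inverse_eq_divide)
qed

text \<open>Every element of \<open>L_dom a\<close> is some \<open>J_op a x\<close>, and by
  injectivity \<open>L_op a\<close> sends it back to \<open>x\<close>.\<close>

lemma pos_semidef_L_iff:
  assumes "regular_param a"
  shows "pos_semidef (L_dom a) (L_op a)
    \<longleftrightarrow> (\<forall>x\<in>J_dom a. ell2_inner (J_op a x) x \<in> \<real>\<^sub>\<ge>\<^sub>0)"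
  using inj_on_J_op[OF assms] by (simp add: pos_semidef_def L_dom_def L_op_def)

lemma J_form_nonneg:
  assumes b: "\<And>n. J_coeff a n \<in> \<real>\<^sub>\<ge>\<^sub>0" and x: "x \<in> J_dom a"
  shows "ell2_inner (J_op a x) x \<in> \<real>\<^sub>\<ge>\<^sub>0"
proof -
  define S where "S = ell2_inner (J_op a x) x"
  have ell2: "x \<in> ell2" "J_op a x \<in> ell2"
    using x by (auto simp: J_dom_def J_op_def)
  have lim: "(\<lambda>N. \<Sum>n\<le>N. cnj (J_op a x n) * x n) \<longlonglongrightarrow> S"
    unfolding S_def ell2_inner_def
    by (rule summable_LIMSEQ'[OF summable_ell2_inner[OF ell2(2,1)]])
  \<comment> \<open>Closedness of the nonnegative reals replaces the extraction of a subsequence: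
    for each \<open>e\<close>, one index \<open>N\<close> beyond \<open>M\<close> with a small
    boundary term suffices, and the weighted sum \<open>T\<close> there approximates
    \<open>S\<close>.\<close>
  have "S \<in> closure \<real>\<^sub>\<ge>\<^sub>0"
  proof (subst closure_approachable, intro allI impI)
    fix e :: real assume "e > 0"
    then have e2: "e / 2 > 0" by simp
    obtain M where M: "dist (\<Sum>n\<le>N. cnj (J_op a x n) * x n) S < e / 2" if "N \<ge> M" for N
      using lim e2 unfolding lim_sequentially by meson
    obtain N where N: "N \<ge> M" "cmod (cnj (\<Sum>n\<le>N. J_op a x n) * x N) < e / 2"
      using ell2_boundary_term_small[OF ell2 e2] by blast
    define T where "T = (\<Sum>n<N. cnj (J_coeff a n) * of_real ((cmod (x n - x (Suc n)))\<^sup>2))"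
    have "T \<in> \<real>\<^sub>\<ge>\<^sub>0"
      using b unfolding T_def by (auto simp: complex_nonneg_Reals_iff intro!: sum_nonneg)
    moreover have "dist T S < e"
    proof -
      have "dist T (\<Sum>n\<le>N. cnj (J_op a x n) * x n) < e / 2"
        using N(2) by (simp only: sum_J_op_form T_def dist_norm) simp
      then show ?thesis
        using M[OF N(1)] dist_triangle[of T S] by (smt (verit) field_sum_of_halves)
    qed
    ultimately show "\<exists>T\<in>\<real>\<^sub>\<ge>\<^sub>0. dist T S < e" by blast
  qed
  then show ?thesis
    by (simp add: S_def closure_closed)
qed

lemma indicator_J_form:
  fixes a :: "nat \<Rightarrow> complex" and N :: nat
  defines "x \<equiv> \<lambda>n. if n \<le> N then 1 else 0"
  shows "x \<in> J_dom a" and "ell2_inner (J_op a x) x = cnj (J_coeff a N)"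
proof -
  \<comment> \<open>Row \<open>n\<close> reads \<open>x\<close> only at \<open>n\<close> and its
    neighbours, all beyond \<open>N\<close> here.\<close>
  have J0: "J_op a x n = 0" if "n \<notin> {..Suc N}" for n
    using that by (cases n) (auto simp: J_op_Suc x_def)
  have "x \<in> ell2"
    unfolding ell2_def by (auto simp: x_def split: if_splits intro!: summable_finite[of "{..N}"])
  moreover have "J_op a x \<in> ell2"
    unfolding ell2_def mem_Collect_eq by (rule summable_finite[of "{..Suc N}"]) (use J0 in auto)
  ultimately show "x \<in> J_dom a"
    by (simp add: J_dom_def J_op_def)
  have "ell2_inner (J_op a x) x = (\<Sum>n\<le>N. cnj (J_op a x n) * x n)"
    unfolding ell2_inner_def by (rule suminf_finite) (auto simp: x_def split: if_splits)
  \<comment> \<open>All differences below \<open>N\<close> vanish; only the boundary term, from the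
    jump between \<open>N\<close> and \<open>Suc N\<close>, survives.\<close>
  also have "\<dots> = cnj (J_coeff a N)"
    unfolding sum_J_op_form sum_J_op by (simp add: x_def)
  finally show "ell2_inner (J_op a x) x = cnj (J_coeff a N)" .
qed

theorem proposition9:
  fixes a :: "nat \<Rightarrow> real"
  assumes "regular_param (\<lambda>n. complex_of_real (a n))"
  shows "pos_semidef (L_dom (\<lambda>n. complex_of_real (a n))) (L_op (\<lambda>n. complex_of_real (a n)))
    \<longleftrightarrow> (\<forall>n. a n > a (Suc n))"
proof -
  let ?a = "\<lambda>n. complex_of_real (a n)"
  have coeff: "J_coeff ?a n = of_real (1 / (a n - a (Suc n)))" for n
    by (simp add: J_coeff_def)
  have sign: "J_coeff ?a n \<in> \<real>\<^sub>\<ge>\<^sub>0 \<longleftrightarrow> a n > a (Suc n)" for n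
  proof -
    \<comment> \<open>Regularity excludes the default value \<open>1 / 0 = 0\<close>, which would
      count as nonnegative without strict decrease.\<close>
    have "a n \<noteq> a (Suc n)"
      using assms by (simp add: regular_param_def)
    then show ?thesis
      unfolding coeff nonneg_Reals_of_real_iff by auto
  qed
  have "(\<forall>x\<in>J_dom ?a. ell2_inner (J_op ?a x) x \<in> \<real>\<^sub>\<ge>\<^sub>0) \<longleftrightarrow> (\<forall>n. J_coeff ?a n \<in> \<real>\<^sub>\<ge>\<^sub>0)"
  proof (intro iffI allI ballI)
    fix n assume "\<forall>x\<in>J_dom ?a. ell2_inner (J_op ?a x) x \<in> \<real>\<^sub>\<ge>\<^sub>0"
    then have "cnj (J_coeff ?a n) \<in> \<real>\<^sub>\<ge>\<^sub>0"
      using indicator_J_form[where N = n and a = ?a] by auto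
    then show "J_coeff ?a n \<in> \<real>\<^sub>\<ge>\<^sub>0"
      by (simp add: coeff)
  qed (use J_form_nonneg in blast)
  then show ?thesis
    by (simp add: pos_semidef_L_iff[OF assms] sign)
qed

end
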